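(* Let $B,K\ge 1$ be integers, let $\mathbf{Y}\in\mathbb{C}^{B\times(K+1)}$ and $\mathbf{G}=\mathbf{Y}^H\mathbf{Y}$. Let $\mathcal{O}\subset\mathbb{C}$ be a finite non-empty constant-modulus set (i.e., there is $\sigma>0$ with $|s|=\sigma$ for all $s\in\mathcal{O}$), and let $\mathcal{C}_{\mathcal{O}}$ be its convex hull. Suppose that the real parameters $\alpha$ and $\beta$ satisfy $\alpha>\|\mathbf{G}\|$ (spectral norm) and $\alpha>\beta>0$. Then any non-zero stationary point $(\mathbf{q}^*,\mathbf{s}^* )$ of the problem $$\underset{\mathbf{s}\in\mathcal{C}_{\mathcal{O}}^{K+1},\ \mathbf{q}\in\mathbb{C}^{K+1}}{\mathrm{minimize}}\ -\|\mathbf{Y}\mathbf{q}\|_2^2+\alpha\|\mathbf{q}-\mathbf{s}\|_2^2-\beta\|\mathbf{s}\|_2^2$$ lies along the boundary of the convex hull, in the sense that $\mathbf{s}^*$ belongs to the (topological) boundary of $\mathcal{C}_{\mathcal{O}}^{K+1}$ in $\mathbb{C}^{K+1}$.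
   Context: The set $\mathcal{C}_{\mathcal{O}}^{K+1}\subset\mathbb{C}^{K+1}$ is the $(K+1)$-fold Cartesian product of the convex hull $\mathcal{C}_{\mathcal{O}}\subset\mathbb{C}$. Up to a factor $\tfrac12$, which does not affect stationarity, the objective function of the problem is $f:\mathbb{C}^{K+1}\times\mathbb{C}^{K+1}\to\mathbb{R}\cup\{\infty\}$, $$f(\mathbf{q},\mathbf{s})=-\tfrac12\|\mathbf{Y}\mathbf{q}\|_2^2+\tfrac{\alpha}{2}\|\mathbf{q}-\mathbf{s}\|_2^2-\tfrac{\beta}{2}\|\mathbf{s}\|_2^2\ \text{ if }\mathbf{s}\in\mathcal{C}_{\mathcal{O}}^{K+1},\qquad f(\mathbf{q},\mathbf{s})=\infty\ \text{ otherwise.}$$ Gradients and sub-gradients are taken by regarding $\mathbb{C}^{K+1}$ as a real Euclidean space with inner product $\Re(\mathbf{x}^H\mathbf{y})$; thus, for $\mathbf{s}\in\mathcal{C}_{\mathcal{O}}^{K+1}$, $\nabla_{\mathbf{q}}f(\mathbf{q},\mathbf{s})=-\mathbf{G}\mathbf{q}+\alpha(\mathbf{q}-\mathbf{s})$. For $\alpha>\beta$ the function $f(\mathbf{q},\cdot)$ is convex for each fixed $\mathbf{q}$. A point $(\mathbf{q},\mathbf{s})$ with $\mathbf{s}\in\mathcal{C}_{\mathcal{O}}^{K+1}$ is a stationary point if $\nabla_{\mathbf{q}}f(\mathbf{q},\mathbf{s})=0$ and $0$ belongs to the (convex) subdifferential of $f(\mathbf{q},\cdot)$ at $\mathbf{s}$.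 It is non-zero if $(\mathbf{q},\mathbf{s})\neq(\mathbf{0},\mathbf{0})$. *)

theory Defs
  imports "HOL-Analysis.Analysis"
begin

(* The type complex^'n carries the Euclidean norm and the real inner product
   x \<bullet> y = Re (x^H y), so the real notions below (GDERIV, the subdifferential,
   frontier, convex hull) refers to C^n as a real Euclidean space. *)

definition conj_transpose :: "complex^'n^'m \<Rightarrow> complex^'m^'n" where
  "conj_transpose A = (\<chi> i j. cnj (A $ j $ i))"

text \<open>For a matrix with respect to Euclidean norms, the operator norm is the spectral norm.\<close>
definition spectral_norm :: "complex^'n^'m \<Rightarrow> real" where
  "spectral_norm A = onorm ((*v) A)"

definition hull_power :: "complex set \<Rightarrow> (complex^'n) set" where
  "hull_power Om = {s. \<forall>i. s $ i \<in> convex hull Om}"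

definition objective ::
    "complex^'n^'b \<Rightarrow> complex set \<Rightarrow> real \<Rightarrow> real \<Rightarrow> complex^'n \<Rightarrow> complex^'n \<Rightarrow> ereal" where
  "objective Y Om \<alpha> \<beta> q s =
     (if s \<in> hull_power Om
      then ereal (- (1/2) * (norm (Y *v q))\<^sup>2 + \<alpha>/2 * (norm (q - s))\<^sup>2 - \<beta>/2 * (norm s)\<^sup>2)
      else \<infinity>)"

definition subdifferential :: "('a::real_inner \<Rightarrow> ereal) \<Rightarrow> 'a \<Rightarrow> 'a set" where
  "subdifferential g x = {v. \<bar>g x\<bar> \<noteq> \<infinity> \<and> (\<forall>y. g x + ereal (v \<bullet> (y - x)) \<le> g y)}"

text \<open>For s in the hull power the objective is finite for all q, so real_of_ereal
  below loses no information.\<close>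
definition stationary_point ::
    "complex^'n^'b \<Rightarrow> complex set \<Rightarrow> real \<Rightarrow> real \<Rightarrow> complex^'n \<Rightarrow> complex^'n \<Rightarrow> bool" where
  "stationary_point Y Om \<alpha> \<beta> q s \<longleftrightarrow>
     s \<in> hull_power Om \<and>
     GDERIV (\<lambda>x. real_of_ereal (objective Y Om \<alpha> \<beta> x s)) q :> 0 \<and>
     0 \<in> subdifferential (objective Y Om \<alpha> \<beta> q) s"

end

theory Submission
  imports Defs
begin

text \<open>
  If \<open>s\<close> were interior, the first-order condition in the second argument would hold with equality and
  give \<open>\<alpha> q = (\<alpha> - \<beta>) s\<close>.  Testing the stationarity condition in the first argument against \<open>q\<close>
  itself then yields \<open>\<parallel>Y q\<parallel>\<^sup>2 + \<beta> (s \<bullet> q) = 0\<close>, where both terms are non-negative because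
  \<open>s\<close> is a positive multiple of \<open>q\<close>, so \<open>q = s = 0\<close>.
\<close>

text \<open>This is the gradient condition \<open>\<alpha> (q - s) = G q\<close> in weak form:
  pairing with a direction \<open>h\<close> turns \<open>G q\<close> into
  \<open>(Y *v q) \<bullet> (Y *v h)\<close>. Since \<open>s\<close> is feasible, the objective is
  finite and quadratic in \<open>x\<close>, and its derivative is unique.\<close>

lemma stationary_point_fst:
  fixes Y :: "complex^'n^'b"
  assumes "stationary_point Y Om \<alpha> \<beta> q s"
  shows "\<alpha> * ((q - s) \<bullet> h) = (Y *v q) \<bullet> (Y *v h)"
proof -
  let ?F = "\<lambda>x. - (1/2) * ((Y *v x) \<bullet> (Y *v x)) + \<alpha>/2 * ((x - s) \<bullet> (x - s)) - \<beta>/2 * (s \<bullet> s)"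
  have "(\<lambda>x. real_of_ereal (objective Y Om \<alpha> \<beta> x s)) = ?F"
    using assms by (simp add: stationary_point_def objective_def power2_norm_eq_inner)
  with assms have "(?F has_derivative (\<lambda>h. 0)) (at q)"
    by (simp add: stationary_point_def gderiv_def)
  moreover note [derivative_intros] =
    bounded_linear.has_derivative[OF matrix_vector_mul_bounded_linear]
  have "(?F has_derivative (\<lambda>h. \<alpha> * ((q - s) \<bullet> h) - (Y *v q) \<bullet> (Y *v h))) (at q)"
    by (auto intro!: derivative_eq_intros simp: inner_commute field_simps)
  ultimately have "(\<lambda>h. 0) = (\<lambda>h. \<alpha> * ((q - s) \<bullet> h) - (Y *v q) \<bullet> (Y *v h))"
    by (rule has_derivative_unique)
  from fun_cong[OF this, of h] show ?thesis
    by simp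
qed

text \<open>A zero subgradient makes \<open>s\<close> a global minimiser of the objective in its
  second argument. Near an interior point the objective is the smooth quadratic \<open>?F\<close>,
  so its gradient must vanish at \<open>s\<close>.\<close>

lemma stationary_point_snd_interior:
  fixes Y :: "complex^'n^'b"
  assumes "stationary_point Y Om \<alpha> \<beta> q s" and "s \<in> interior (hull_power Om)"
  shows "\<alpha> *\<^sub>R q = (\<alpha> - \<beta>) *\<^sub>R s"
proof -
  let ?F = "\<lambda>y. - (1/2) * (norm (Y *v q))\<^sup>2 + \<alpha>/2 * ((q - y) \<bullet> (q - y)) - \<beta>/2 * (y \<bullet> y)"
  have s: "s \<in> hull_power Om"
    using assms(2) interior_subset by blast
  \<comment> \<open>\<open>?F\<close> agrees with the objective only on the hull power; restricting
    to its interior gives the open set on which Fermat's criterion applies.\<close>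
  have min: "?F s \<le> ?F y" if "y \<in> interior (hull_power Om)" for y
  proof -
    have "y \<in> hull_power Om"
      using that interior_subset by blast
    moreover have "objective Y Om \<alpha> \<beta> q s \<le> objective Y Om \<alpha> \<beta> q y"
      using assms(1) by (simp add: stationary_point_def subdifferential_def flip: zero_ereal_def)
    ultimately show ?thesis
      using s by (simp add: objective_def power2_norm_eq_inner)
  qed
  have "(?F has_derivative (\<lambda>h. ((\<alpha> - \<beta>) *\<^sub>R s - \<alpha> *\<^sub>R q) \<bullet> h)) (at s)"
    by (auto intro!: derivative_eq_intros simp: inner_commute algebra_simps)
  with assms(2) min have "(\<lambda>h. ((\<alpha> - \<beta>) *\<^sub>R s - \<alpha> *\<^sub>R q) \<bullet> h) = (\<lambda>h. 0)"
    by (intro differential_zero_maxmin[where S = "interior (hull_power Om)" and f = ?F]) auto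
  from fun_cong[OF this, of "(\<alpha> - \<beta>) *\<^sub>R s - \<alpha> *\<^sub>R q"] show ?thesis
    by simp
qed

theorem theorem2:
  fixes B K :: nat
    and Y :: "complex^'n^'b" and G :: "complex^'n^'n"
    and Om :: "complex set"
    and \<sigma> \<alpha> \<beta> :: real
    and q s :: "complex^'n"
  assumes "B \<ge> 1" and "K \<ge> 1"
    and "CARD('b) = B" and "CARD('n) = K + 1"
    and "G = conj_transpose Y ** Y"
    and "finite Om" and "Om \<noteq> {}"
    and "\<sigma> > 0" and "\<forall>z\<in>Om. cmod z = \<sigma>"
    and "\<alpha> > spectral_norm G"
    and "\<alpha> > \<beta>" and "\<beta> > 0"
    and "stationary_point Y Om \<alpha> \<beta> q s"
    and "(q, s) \<noteq> (0, 0)"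
  shows "s \<in> frontier (hull_power Om)"
proof (rule ccontr)
  assume "s \<notin> frontier (hull_power Om)"
  moreover have "s \<in> hull_power Om"
    using assms(13) by (simp add: stationary_point_def)
  ultimately have "s \<in> interior (hull_power Om)"
    using closure_subset by (auto simp: frontier_def)
  with assms(13) have eq: "\<alpha> *\<^sub>R q = (\<alpha> - \<beta>) *\<^sub>R s"
    by (rule stationary_point_snd_interior)
  have "\<alpha> * (s \<bullet> q) = \<alpha> * (q \<bullet> q) + \<beta> * (s \<bullet> q)"
    using arg_cong[OF eq, of "\<lambda>x. x \<bullet> q"] by (simp add: algebra_simps)
  moreover have "\<alpha> * (q \<bullet> q) - \<alpha> * (s \<bullet> q) = (Y *v q) \<bullet> (Y *v q)"
    using stationary_point_fst[OF assms(13), of q] by (simp add: algebra_simps)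
  \<comment> \<open>Adding the two identities cancels the \<open>\<alpha>\<close> terms and leaves
    \<open>- \<beta> * (s \<bullet> q)\<close> equal to the squared norm of
    \<open>Y *v q\<close>.\<close>
  ultimately have "\<beta> * (s \<bullet> q) \<le> 0"
    using inner_ge_zero[of "Y *v q"] by linarith
  then have "s \<bullet> q \<le> 0"
    using \<open>\<beta> > 0\<close> by (simp add: mult_le_0_iff)
  then have "(\<alpha> - \<beta>) * (s \<bullet> q) \<le> 0"
    using \<open>\<alpha> > \<beta>\<close> by (simp add: mult_le_0_iff)
  \<comment> \<open>Pairing \<open>eq\<close> with \<open>q\<close> gives \<open>\<alpha> * (q
    \<bullet> q) = (\<alpha> - \<beta>) * (s \<bullet> q)\<close>, which transfers the sign bound to
    \<open>q \<bullet> q\<close>.\<close>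
  with arg_cong[OF eq, of "\<lambda>x. x \<bullet> q"] have "\<alpha> * (q \<bullet> q) \<le> 0"
    by simp
  then have "q \<bullet> q \<le> 0"
    using \<open>\<alpha> > \<beta>\<close> \<open>\<beta> > 0\<close> by (simp add: mult_le_0_iff)
  then have "q = 0"
    using inner_gt_zero_iff[of q] by linarith
  with eq \<open>\<alpha> > \<beta>\<close> have "s = 0"
    by simp
  with \<open>q = 0\<close> \<open>(q, s) \<noteq> (0, 0)\<close> show False
    by simp
qed

end
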